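(* Let $\mathcal{X}$ be a compact subset of a Euclidean space, $k$ a continuous positive definite kernel on $\mathcal{X}$ with $\sup_{x\in\mathcal{X}}k(x,x)\le1$, $\mathcal{H}_k$ its RKHS and $\mathcal{H}_k^1$ the closed unit ball of $\mathcal{H}_k$. Let $\rho$ be a Borel probability measure on $\mathcal{X}$, and let $(\lambda_i)_{i\ge1}$ be the eigenvalues of $(K_\rho g)(x)=\int_{\mathcal{X}}k(x,x')g(x')\,d\rho(x')$ on $L^2(\rho)$, listed in nonincreasing order with multiplicity (padded with zeros if there are finitely many nonzero ones). Let $n\ge1$, $x_1,\dots,x_n\in\mathcal{X}$, and let $\mathcal{G}_n:\mathcal{H}_k^1\to C(\mathcal{X})$ be any map (not necessarily linear) such that $\mathcal{G}_nf=\mathcal{G}_nf'$ whenever $f,f'\in\mathcal{H}_k^1$ satisfy $f(x_i)=f'(x_i)$ for $i=1,\dots,n$. Then: (1) $\displaystyle\sup_{f\in\mathcal{H}_k^1}\|f-\mathcal{G}_nf\|_\infty\ge\Big(\sum_{i=n+1}^\infty\lambda_i\Big)^{1/2}$. (2) If in addition $\mathcal{G}_nf(x)\ge f(x)$ for all $f\in\mathcal{H}_k^1$ and $x\in\mathcal{X}$, then $\displaystyle\sup_{f\in\mathcal{H}_k^1}\mathbb{E}_{x\sim\rho}[\mathcal{G}_nf(x)-f(x)]\ge\sum_{i=n+1}^\infty\lambda_i$.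
   Context: A continuous positive definite kernel $k$ on $\mathcal{X}$ is a continuous symmetric function with $\sum_{i,j}a_ia_jk(x_i,x_j)\ge0$ for all finite families; $\mathcal{H}_k$ is the associated reproducing kernel Hilbert space ($k(x,\cdot)\in\mathcal{H}_k$ and $f(x)=\langle f,k(x,\cdot)\rangle_{\mathcal{H}_k}$). $C(\mathcal{X})$ is the space of bounded continuous functions with sup norm $\|\cdot\|_\infty$. *)

theory Defs
  imports "HOL-Probability.Probability"
begin

definition pd_kernel :: "'a set \<Rightarrow> ('a \<Rightarrow> 'a \<Rightarrow> real) \<Rightarrow> bool" where
  "pd_kernel X k \<longleftrightarrow>
     (\<forall>x\<in>X. \<forall>y\<in>X. k x y = k y x) \<and>
     (\<forall>(m::nat) (xs::nat \<Rightarrow> 'a) (a::nat \<Rightarrow> real). (\<forall>i<m. xs i \<in> X) \<longrightarrow>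
        0 \<le> (\<Sum>i<m. \<Sum>j<m. a i * a j * k (xs i) (xs j)))"

text \<open>The RKHS H_k, given as a Hilbert space 'h together with the representers
  phi x = k(x,.) in H_k: reproducing identity on the representers, and H_k is the
  closed span of the representers.  An element h is identified with the function
  x \<mapsto> <h, phi x> on X (reproducing property).\<close>
definition rkhs_repr :: "'a set \<Rightarrow> ('a \<Rightarrow> 'a \<Rightarrow> real) \<Rightarrow> ('a \<Rightarrow> 'h::real_inner) \<Rightarrow> bool" where
  "rkhs_repr X k phi \<longleftrightarrow>
     (\<forall>x\<in>X. \<forall>y\<in>X. inner (phi x) (phi y) = k x y) \<and> closure (span (phi ` X)) = UNIV"

definition rkhs_unit_ball :: "'a set \<Rightarrow> ('a \<Rightarrow> 'h::real_inner) \<Rightarrow> ('a \<Rightarrow> real) set" where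
  "rkhs_unit_ball X phi = (\<lambda>h x. if x \<in> X then inner h (phi x) else 0) ` {h. norm h \<le> 1}"

definition kernel_int_op :: "'a measure \<Rightarrow> ('a \<Rightarrow> 'a \<Rightarrow> real) \<Rightarrow> ('a \<Rightarrow> real) \<Rightarrow> 'a \<Rightarrow> real" where
  "kernel_int_op \<rho> k g = (\<lambda>x. integral\<^sup>L \<rho> (\<lambda>y. k x y * g y))"

text \<open>The eigenspace of K_rho in L^2(rho) for mu contains an orthonormal family of size m
  (equivalently, the eigenspace has dimension at least m).\<close>
definition eig_orthonormal_family :: "'a measure \<Rightarrow> ('a \<Rightarrow> 'a \<Rightarrow> real) \<Rightarrow> real \<Rightarrow> nat \<Rightarrow> bool" where
  "eig_orthonormal_family \<rho> k \<mu> m \<longleftrightarrow>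
     (\<exists>g::nat \<Rightarrow> 'a \<Rightarrow> real.
        (\<forall>i<m. g i \<in> borel_measurable \<rho> \<and> integrable \<rho> (\<lambda>x. (g i x)\<^sup>2) \<and>
               (AE x in \<rho>. kernel_int_op \<rho> k (g i) x = \<mu> * g i x)) \<and>
        (\<forall>i<m. \<forall>j<m. integral\<^sup>L \<rho> (\<lambda>x. g i x * g j x) = (if i = j then 1 else 0)))"

text \<open>lam is the eigenvalue sequence of K_rho on L^2(rho), nonincreasing, each nonzero
  eigenvalue repeated according to (the dimension of its eigenspace), padded with zeros.
  Index 0 here corresponds to lambda_1 in the paper.\<close>
definition kernel_eigenvalues :: "'a measure \<Rightarrow> ('a \<Rightarrow> 'a \<Rightarrow> real) \<Rightarrow> (nat \<Rightarrow> real) \<Rightarrow> bool" where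
  "kernel_eigenvalues \<rho> k lam \<longleftrightarrow>
     antimono lam \<and>
     (\<forall>\<mu>. \<mu> \<noteq> 0 \<longrightarrow> finite {i. lam i = \<mu>} \<and>
        (\<forall>m. eig_orthonormal_family \<rho> k \<mu> m \<longleftrightarrow> m \<le> card {i. lam i = \<mu>}))"

end

theory Submission
  imports Defs
begin

text \<open>
  Let \<open>Q\<close> be the orthogonal projection of \<open>H\<^sub>k\<close> onto the complement of the span of
  \<open>k(x\<^sub>1,\<cdot>), \<dots>, k(x\<^sub>n,\<cdot>)\<close>, and let \<open>p(x) = \<parallel>Q k(x,\<cdot>)\<parallel>\<close>.  The functions \<open>\<plusminus>Q k(x,\<cdot>) / p(x)\<close> lie in the
  unit ball and vanish at the nodes, so \<open>G\<close> maps both to the same function as \<open>0\<close>.  Hence the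
  worst-case error is at least \<open>sup p\<close>, and \<open>G 0 \<ge> p \<ge> p\<^sup>2\<close> for upper approximations.  It remains to see
  that \<open>\<integral> p\<^sup>2 d\<rho>\<close> is at least the tail sum of the eigenvalues.

  For orthonormal eigenfunctions \<open>g\<^sub>i\<close> the vectors \<open>t\<^sub>i = \<integral> g\<^sub>i(x) k(x,\<cdot>) d\<rho>\<close> are orthogonal with
  \<open>\<parallel>t\<^sub>i\<parallel>\<^sup>2 = \<lambda>\<^sub>i\<close>, and integrating \<open>\<parallel>Q (k(x,\<cdot>) - \<Sum>\<^sub>i g\<^sub>i(x) t\<^sub>i)\<parallel>\<^sup>2 \<ge> 0\<close> gives
  \<open>\<Sum>\<^sub>i \<parallel>Q t\<^sub>i\<parallel>\<^sup>2 \<le> \<integral> p\<^sup>2 d\<rho>\<close>.  The left side equals \<open>\<Sum>\<^sub>i \<lambda>\<^sub>i (1 - c\<^sub>i)\<close> with \<open>0 \<le> c\<^sub>i \<le> 1\<close> and, by Bessel's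
  inequality, \<open>\<Sum>\<^sub>i c\<^sub>i \<le> n\<close>; since \<open>\<lambda>\<close> is nonincreasing this is at least \<open>\<Sum>\<^sub>i\<^sub>>\<^sub>n \<lambda>\<^sub>i\<close>.
  Only Bessel's inequality is involved, so neither Mercer's theorem nor completeness of the
  eigenfunctions is needed.
\<close>

section \<open>Orthonormal families in real inner product spaces\<close>

definition orthonormal :: "'h::real_inner set \<Rightarrow> bool" where
  "orthonormal U \<longleftrightarrow> finite U \<and> (\<forall>u\<in>U. \<forall>v\<in>U. inner u v = (if u = v then 1 else 0))"

text \<open>For orthonormal \<open>U\<close> this is the projection of \<open>v\<close> onto the
  orthogonal complement of \<open>span U\<close>, the map Q of the introduction.\<close>

definition residual :: "'h::real_inner set \<Rightarrow> 'h \<Rightarrow> 'h" where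
  "residual U v = v - (\<Sum>u\<in>U. inner v u *\<^sub>R u)"

lemma orthonormal_basis_exists:
  fixes B :: "'h::real_inner set"
  assumes "finite B"
  obtains U where "orthonormal U" "card U \<le> card B" "span U = span B"
proof -
  obtain C where C: "finite C" "card C \<le> card B" "span C = span B" "pairwise orthogonal C"
    using basis_orthogonal[OF assms] by blast
  \<comment> \<open>The orthogonalised set \<open>C\<close> may contain 0 (for instance if
    \<open>B\<close> is linearly dependent), which must go before normalising.\<close>
  define D where "D = C - {0}"
  define U where "U = (\<lambda>c. c /\<^sub>R norm c) ` D"
  have fin: "finite D" "card D \<le> card C"
    using C(1) by (auto simp: D_def card_Diff1_le)
  have "orthonormal U"
    unfolding orthonormal_def
  proof (intro conjI ballI)
    show "finite U" using fin by (simp add: U_def)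
  next
    fix u v assume "u \<in> U" "v \<in> U"
    then obtain c d where cd: "c \<in> D" "d \<in> D" "u = c /\<^sub>R norm c" "v = d /\<^sub>R norm d"
      by (auto simp: U_def)
    have self: "inner u u = 1" if "c \<noteq> 0" "u = c /\<^sub>R norm c" for c u :: 'h
      using that by (simp add: dot_square_norm power2_eq_square)
    show "inner u v = (if u = v then 1 else 0)"
    proof (cases "c = d")
      case True
      then show ?thesis using self[of c u] cd by (auto simp: D_def)
    next
      case False
      then have "inner c d = 0"
        using C(4) cd by (auto simp: pairwise_def orthogonal_def D_def)
      then have "inner u v = 0" using cd by simp
      moreover have "inner u u = 1" using self[of c u] cd by (auto simp: D_def)
      ultimately show ?thesis by auto
    qed
  qed
  moreover have "card U \<le> card B"
    using fin C(2) card_image_le[of D "\<lambda>c. c /\<^sub>R norm c"] by (simp add: U_def)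
  moreover have "span U = span B"
  proof -
    have "U \<subseteq> span C"
      unfolding U_def D_def by (intro image_subsetI span_scale span_base) simp
    moreover have "C \<subseteq> span U"
    proof
      fix c assume "c \<in> C"
      show "c \<in> span U"
      proof (cases "c = 0")
        case False
        then have "c /\<^sub>R norm c \<in> span U"
          using \<open>c \<in> C\<close> by (auto simp: U_def D_def intro!: span_base)
        then have "norm c *\<^sub>R (c /\<^sub>R norm c) \<in> span U" by (rule span_scale)
        then show ?thesis using False by simp
      qed (simp add: span_zero)
    qed
    ultimately have "span U = span C"
      by (metis span_eq)
    then show ?thesis using C(3) by simp
  qed
  ultimately show ?thesis using that by blast
qed

lemma residual_diff: "residual U (v - w) = residual U v - residual U w"
  by (simp add: residual_def inner_diff_left scaleR_diff_left sum_subtractf)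

lemma inner_residual_left: "inner (residual U v) w = inner v w - (\<Sum>u\<in>U. inner v u * inner w u)"
  unfolding residual_def inner_diff_left inner_sum_left inner_scaleR_left inner_commute[of w] ..

lemma inner_residual_orthonormal:
  assumes "orthonormal U" "u \<in> U"
  shows "inner (residual U v) u = 0"
proof -
  have "(\<Sum>w\<in>U. inner v w * inner u w) = (\<Sum>w\<in>U. if w = u then inner v w else 0)"
    using assms by (intro sum.cong) (auto simp: orthonormal_def)
  also have "\<dots> = inner v u" using assms by (simp add: orthonormal_def)
  finally show ?thesis by (simp add: inner_residual_left)
qed

lemma inner_residual_span:
  assumes "orthonormal U" "b \<in> span U"
  shows "inner (residual U v) b = 0"
  using assms(2)
  by (induction rule: span_induct_alt)
     (auto simp: inner_add_right inner_residual_orthonormal[OF assms(1)])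

text \<open>Q is self-adjoint and idempotent: the part removed from \<open>v\<close> lies in
  \<open>span U\<close>, hence is orthogonal to \<open>residual U w\<close>.\<close>

lemma inner_residual_residual:
  assumes "orthonormal U"
  shows "inner (residual U v) (residual U w) = inner v (residual U w)"
proof -
  have "inner (residual U v) (residual U w)
      = inner v (residual U w) - inner (\<Sum>u\<in>U. inner v u *\<^sub>R u) (residual U w)"
    by (simp add: residual_def[of U v] inner_diff_left)
  also have "inner (\<Sum>u\<in>U. inner v u *\<^sub>R u) (residual U w) = 0"
    unfolding inner_commute[of _ "residual U w"] inner_sum_right inner_scaleR_right
    using inner_residual_orthonormal[OF assms] by simp
  finally show ?thesis by simp
qed

lemma norm_residual_sq:
  assumes "orthonormal U"
  shows "(norm (residual U v))\<^sup>2 = (norm v)\<^sup>2 - (\<Sum>u\<in>U. (inner v u)\<^sup>2)"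
proof -
  have "(norm (residual U v))\<^sup>2 = inner (residual U v) v"
    by (simp add: power2_norm_eq_inner inner_residual_residual[OF assms] inner_commute)
  then show ?thesis
    by (simp add: inner_residual_left power2_norm_eq_inner) (simp add: power2_eq_square)
qed

lemma bessel_finite:
  assumes "orthonormal U"
  shows "(\<Sum>u\<in>U. (inner v u)\<^sup>2) \<le> (norm v)\<^sup>2"
  using norm_residual_sq[OF assms, of v] zero_le_power2[of "norm (residual U v)"] by linarith

text \<open>Best approximation: Q annihilates \<open>b\<close> and does not increase norms, so it
  can be applied to \<open>v - b\<close> instead of \<open>v\<close>.\<close>

lemma norm_residual_le_dist:
  assumes "orthonormal U" "b \<in> span U"
  shows "norm (residual U v) \<le> norm (v - b)"
proof -
  have "residual U b = 0"
    using inner_residual_residual[OF assms(1), of b b] inner_residual_span[OF assms, of b]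
    by (simp add: inner_commute)
  then have "residual U v = residual U (v - b)" by (simp add: residual_diff)
  moreover have "(norm (residual U (v - b)))\<^sup>2 \<le> (norm (v - b))\<^sup>2"
    by (simp add: norm_residual_sq[OF assms(1)] sum_nonneg)
  ultimately show ?thesis using power2_le_imp_le[OF _ norm_ge_zero] by metis
qed

section \<open>Weak integrals of continuous feature maps\<close>

lemma integrable_mult_square_integrable:
  fixes f g :: "'a \<Rightarrow> real"
  assumes [measurable]: "f \<in> borel_measurable M" "g \<in> borel_measurable M"
    and "integrable M (\<lambda>x. (f x)\<^sup>2)" "integrable M (\<lambda>x. (g x)\<^sup>2)"
  shows "integrable M (\<lambda>x. f x * g x)"
proof (rule Bochner_Integration.integrable_bound)
  show "integrable M (\<lambda>x. (f x)\<^sup>2 + (g x)\<^sup>2)" using assms by simp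
  have "\<bar>a * b\<bar> \<le> a\<^sup>2 + b\<^sup>2" for a b :: real
  proof -
    have "2 * \<bar>a\<bar> * \<bar>b\<bar> \<le> a\<^sup>2 + b\<^sup>2"
      using sum_squares_bound[of "\<bar>a\<bar>" "\<bar>b\<bar>"] by simp
    moreover have "0 \<le> \<bar>a\<bar> * \<bar>b\<bar>" by simp
    ultimately show ?thesis unfolding abs_mult by linarith
  qed
  then show "AE x in M. norm (f x * g x) \<le> norm ((f x)\<^sup>2 + (g x)\<^sup>2)" by simp
qed measurable

locale compact_feature_map = prob_space M for M :: "'a::topological_space measure" +
  fixes X :: "'a set" and \<phi> :: "'a \<Rightarrow> 'h::{real_inner,complete_space}"
  assumes compact_X: "compact X" and continuous_\<phi>: "continuous_on X \<phi>"
    and space_M: "space M = X" and sets_M: "sets M = sets (restrict_space borel X)"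
begin

lemma measurable_continuous_on:
  fixes f :: "'a \<Rightarrow> real"
  assumes "continuous_on X f"
  shows "f \<in> borel_measurable M"
  using borel_measurable_continuous_on_restrict[OF assms] measurable_cong_sets[OF sets_M refl] by blast

lemma integrable_continuous_on:
  fixes f :: "'a \<Rightarrow> real"
  assumes "continuous_on X f"
  shows "integrable M f"
proof -
  have "bounded (f ` X)"
    using compact_continuous_image[OF assms compact_X] by (rule compact_imp_bounded)
  then obtain B where "\<forall>x\<in>X. norm (f x) \<le> B" by (auto simp: bounded_iff)
  then show ?thesis
    using measurable_continuous_on[OF assms]
    by (intro integrable_const_bound[of _ B]) (auto simp: space_M)
qed

lemma integrable_mult_continuous_on:
  fixes f g :: "'a \<Rightarrow> real"
  assumes "continuous_on X f" "integrable M g"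
  shows "integrable M (\<lambda>x. f x * g x)"
proof -
  have "bounded (f ` X)"
    using compact_continuous_image[OF assms(1) compact_X] by (rule compact_imp_bounded)
  then obtain B where B: "\<forall>x\<in>X. \<bar>f x\<bar> \<le> B" by (auto simp: bounded_iff)
  note [measurable] = measurable_continuous_on[OF assms(1)] borel_measurable_integrable[OF assms(2)]
  show ?thesis
  proof (rule Bochner_Integration.integrable_bound)
    show "integrable M (\<lambda>x. B * g x)" using assms(2) by simp
    show "AE x in M. norm (f x * g x) \<le> norm (B * g x)"
      using B by (intro AE_I2) (force simp: space_M abs_mult intro!: mult_right_mono)
  qed measurable
qed

lemma integrable_square_integrable:
  fixes g :: "'a \<Rightarrow> real"
  assumes "g \<in> borel_measurable M" "integrable M (\<lambda>x. (g x)\<^sup>2)"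
  shows "integrable M g"
  using integrable_mult_square_integrable[of g M "\<lambda>_. 1"] assms by simp

lemma continuous_inner [intro]: "continuous_on X (\<lambda>x. inner (\<phi> x) h)"
  by (intro continuous_intros continuous_\<phi>)

text \<open>The compact set of all \<open>\<phi> x\<close> is totally bounded, so it stays within
  \<open>\<epsilon>\<close> of one finite-dimensional subspace. Integrating the projection onto that
  subspace is elementary, and the error is the integral of the residual against
  \<open>g\<close>.\<close>

lemma approximate_weak_integral:
  assumes g: "integrable M g" and "\<epsilon> > 0"
  shows "\<exists>v. \<forall>h. \<bar>inner v h - (\<integral>x. inner (\<phi> x) h * g x \<partial>M)\<bar>
                   \<le> \<epsilon> * norm h * (\<integral>x. \<bar>g x\<bar> \<partial>M)"
proof -
  have "compact (\<phi> ` X)" using continuous_\<phi> compact_X by (rule compact_continuous_image)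
  then obtain B where B: "finite B" "\<phi> ` X \<subseteq> (\<Union>b\<in>B. ball b \<epsilon>)"
    using compactE_image[of "\<phi> ` X" "\<phi> ` X" "\<lambda>b. ball b \<epsilon>"] \<open>\<epsilon> > 0\<close>
    by (metis UN_I centre_in_ball open_ball subsetI)
  obtain U where U: "orthonormal U" "span U = span B"
    using orthonormal_basis_exists[OF B(1)] by metis
  have close: "norm (residual U (\<phi> x)) \<le> \<epsilon>" if "x \<in> X" for x
  proof -
    have "\<phi> x \<in> (\<Union>b\<in>B. ball b \<epsilon>)" using B(2) that by blast
    then obtain b where "b \<in> B" "dist b (\<phi> x) < \<epsilon>" by auto
    then show ?thesis
      using norm_residual_le_dist[OF U(1), of b "\<phi> x"] U(2)
      by (simp add: dist_norm norm_minus_commute span_base)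
  qed
  \<comment> \<open>The integral of \<open>g x\<close> times the projection of
    \<open>\<phi> x\<close> onto \<open>span U\<close>, taken coordinate by coordinate.\<close>
  define v where "v = (\<Sum>u\<in>U. (\<integral>x. inner (\<phi> x) u * g x \<partial>M) *\<^sub>R u)"
  have int: "integrable M (\<lambda>x. inner (\<phi> x) h * g x)" for h
    by (rule integrable_mult_continuous_on[OF continuous_inner g])
  have "\<bar>inner v h - (\<integral>x. inner (\<phi> x) h * g x \<partial>M)\<bar> \<le> \<epsilon> * norm h * (\<integral>x. \<bar>g x\<bar> \<partial>M)" for h
  proof -
    have eq: "inner (residual U (\<phi> x)) h * g x
        = inner (\<phi> x) h * g x - (\<Sum>u\<in>U. inner h u * (inner (\<phi> x) u * g x))" for x
      unfolding inner_residual_left left_diff_distrib sum_distrib_right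
      by (intro arg_cong2[where f = minus] sum.cong refl) (simp only: mult_ac)
    have intr: "integrable M (\<lambda>x. inner (residual U (\<phi> x)) h * g x)"
      unfolding eq by (intro Bochner_Integration.integrable_diff Bochner_Integration.integrable_sum
          integrable_mult_right int)
    have "inner v h = (\<integral>x. (\<Sum>u\<in>U. inner h u * (inner (\<phi> x) u * g x)) \<partial>M)"
      using int by (simp add: v_def inner_sum_left inner_commute[of h] mult.commute[of "inner _ h"])
    then have "(\<integral>x. inner (\<phi> x) h * g x \<partial>M) - inner v h
        = (\<integral>x. inner (residual U (\<phi> x)) h * g x \<partial>M)"
      unfolding eq using int by (subst Bochner_Integration.integral_diff) auto
    also have "\<bar>\<dots>\<bar> \<le> (\<integral>x. \<bar>inner (residual U (\<phi> x)) h * g x\<bar> \<partial>M)"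
      by (rule integral_abs_bound)
    also have "\<dots> \<le> (\<integral>x. \<epsilon> * norm h * \<bar>g x\<bar> \<partial>M)"
    proof (rule integral_mono)
      fix x assume "x \<in> space M"
      then have "\<bar>inner (residual U (\<phi> x)) h\<bar> \<le> \<epsilon> * norm h"
        using Cauchy_Schwarz_ineq2[of "residual U (\<phi> x)" h] close[of x]
        by (smt (verit) mult_right_mono norm_ge_zero space_M)
      then show "\<bar>inner (residual U (\<phi> x)) h * g x\<bar> \<le> \<epsilon> * norm h * \<bar>g x\<bar>"
        by (simp add: abs_mult mult_right_mono)
    qed (use intr g in auto)
    finally show ?thesis by (simp add: abs_minus_commute)
  qed
  then show ?thesis by blast
qed

text \<open>Approximate integrals of accuracy 1/(m+1) form a Cauchy sequence, and completeness
  supplies a limit, which represents the functional \<open>L\<close>.\<close>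

lemma weak_integral_exists:
  assumes g: "integrable M g"
  shows "\<exists>v. \<forall>h. inner v h = (\<integral>x. inner (\<phi> x) h * g x \<partial>M)"
proof -
  define C where "C = (\<integral>x. \<bar>g x\<bar> \<partial>M)"
  define L where "L h = (\<integral>x. inner (\<phi> x) h * g x \<partial>M)" for h
  have "C \<ge> 0" by (simp add: C_def)
  have "\<exists>v. \<forall>h. \<bar>inner v h - L h\<bar> \<le> inverse (real (Suc m)) * norm h * C" for m
    unfolding C_def L_def by (rule approximate_weak_integral[OF g]) simp
  then obtain v where v: "\<bar>inner (v m) h - L h\<bar> \<le> inverse (real (Suc m)) * norm h * C" for m h
    by metis
  have dist_v: "dist (v m) (v l) \<le> (inverse (real (Suc m)) + inverse (real (Suc l))) * C" for m l
  proof (cases "v m = v l")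
    case False
    \<comment> \<open>Testing both approximations against their own difference bounds the square of
      \<open>norm d\<close> by a multiple of \<open>norm d\<close>, and one factor cancels.\<close>
    define d where "d = v m - v l"
    have "(norm d)\<^sup>2 = (inner (v m) d - L d) - (inner (v l) d - L d)"
      by (simp add: d_def power2_norm_eq_inner inner_diff_left)
    also have "\<dots> \<le> inverse (real (Suc m)) * norm d * C + inverse (real (Suc l)) * norm d * C"
      using v[of m d] v[of l d] by linarith
    finally have "norm d * norm d \<le> norm d * ((inverse (real (Suc m)) + inverse (real (Suc l))) * C)"
      by (simp add: power2_eq_square algebra_simps)
    moreover have "norm d > 0" using False by (simp add: d_def)
    ultimately show ?thesis by (simp add: dist_norm d_def)
  qed (use \<open>C \<ge> 0\<close> in simp)
  have lim0: "(\<lambda>m. inverse (real (Suc m)) * c) \<longlonglongrightarrow> 0" for c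
    using tendsto_mult_left_zero[OF LIMSEQ_inverse_real_of_nat] .
  have "Cauchy v"
  proof (rule metric_CauchyI)
    fix e :: real assume "e > 0"
    then obtain N where N: "\<And>m. m \<ge> N \<Longrightarrow> inverse (real (Suc m)) * C < e / 2"
      using order_tendstoD(2)[OF lim0[of C], of "e / 2"] by (auto simp: eventually_sequentially)
    have "dist (v m) (v l) < e" if "m \<ge> N" "l \<ge> N" for m l
      using dist_v[of m l] N[OF that(1)] N[OF that(2)] by (simp add: algebra_simps)
    then show "\<exists>N. \<forall>m\<ge>N. \<forall>l\<ge>N. dist (v m) (v l) < e" by blast
  qed
  then obtain w where w: "v \<longlonglongrightarrow> w" using Cauchy_convergent convergent_def by blast
  have "inner w h = L h" for h
  proof (rule LIMSEQ_unique)
    show "(\<lambda>m. inner (v m) h) \<longlonglongrightarrow> inner w h" by (intro tendsto_intros w)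
    have "(\<lambda>m. inner (v m) h - L h) \<longlonglongrightarrow> 0"
      using v[of _ h] by (intro Lim_null_comparison[OF _ lim0[of "norm h * C"]]) (auto simp: mult.assoc)
    then show "(\<lambda>m. inner (v m) h) \<longlonglongrightarrow> L h" by (simp add: LIM_zero_iff)
  qed
  then show ?thesis by (auto simp: L_def)
qed

text \<open>The Bochner integral of the library requires a second-countable type, which \<open>'h\<close> need not be.\<close>
definition weak_integral :: "('a \<Rightarrow> real) \<Rightarrow> 'h" where
  "weak_integral g = (SOME v. \<forall>h. inner v h = (\<integral>x. inner (\<phi> x) h * g x \<partial>M))"

lemma inner_weak_integral:
  assumes "integrable M g"
  shows "inner (weak_integral g) h = (\<integral>x. inner (\<phi> x) h * g x \<partial>M)"
  using someI_ex[OF weak_integral_exists[OF assms]] unfolding weak_integral_def by blast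

lemma continuous_residual: "continuous_on X (\<lambda>x. residual U (\<phi> x))"
  unfolding residual_def by (intro continuous_intros continuous_\<phi>)

text \<open>The integral of the squared norm of the residual of
  \<open>\<phi> x - (\<Sum>i. g i x *\<^sub>R weak_integral (g i))\<close> is the difference of the two sides.\<close>
lemma sum_residual_weak_integral_le:
  fixes g :: "'i \<Rightarrow> 'a \<Rightarrow> real"
  assumes U: "orthonormal U" and I: "finite I"
    and meas: "\<And>i. i \<in> I \<Longrightarrow> g i \<in> borel_measurable M"
    and sq: "\<And>i. i \<in> I \<Longrightarrow> integrable M (\<lambda>x. (g i x)\<^sup>2)"
    and orth: "\<And>i j. i \<in> I \<Longrightarrow> j \<in> I \<Longrightarrow> (\<integral>x. g i x * g j x \<partial>M) = (if i = j then 1 else 0)"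
  shows "(\<Sum>i\<in>I. (norm (residual U (weak_integral (g i))))\<^sup>2) \<le> (\<integral>x. (norm (residual U (\<phi> x)))\<^sup>2 \<partial>M)"
proof -
  define r where "r i = residual U (weak_integral (g i))" for i
  have gint: "integrable M (g i)" if "i \<in> I" for i
    using integrable_square_integrable[OF meas[OF that] sq[OF that]] .
  have expand: "(norm (residual U (\<phi> x) - (\<Sum>i\<in>I. g i x *\<^sub>R r i)))\<^sup>2
      = (norm (residual U (\<phi> x)))\<^sup>2 - 2 * (\<Sum>i\<in>I. inner (\<phi> x) (r i) * g i x)
        + (\<Sum>i\<in>I. \<Sum>j\<in>I. inner (r i) (r j) * (g i x * g j x))" for x
  proof -
    have "(norm (a - b))\<^sup>2 = (norm a)\<^sup>2 - 2 * inner a b + inner b b" for a b :: 'h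
      by (simp add: power2_norm_eq_inner inner_diff_left inner_diff_right inner_commute)
    moreover have "inner (residual U (\<phi> x)) (\<Sum>i\<in>I. g i x *\<^sub>R r i) = (\<Sum>i\<in>I. inner (\<phi> x) (r i) * g i x)"
      by (simp add: inner_sum_right r_def inner_residual_residual[OF U] mult.commute)
    moreover have "inner (\<Sum>i\<in>I. g i x *\<^sub>R r i) (\<Sum>i\<in>I. g i x *\<^sub>R r i)
        = (\<Sum>i\<in>I. \<Sum>j\<in>I. inner (r i) (r j) * (g i x * g j x))"
      unfolding inner_sum_left inner_sum_right
      by (intro sum.cong refl) (simp add: inner_commute mult_ac)
    ultimately show ?thesis by simp
  qed
  have int1: "integrable M (\<lambda>x. (norm (residual U (\<phi> x)))\<^sup>2)"
    by (intro integrable_continuous_on continuous_intros continuous_residual)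
  have int2: "integrable M (\<lambda>x. inner (\<phi> x) (r i) * g i x)" if "i \<in> I" for i
    by (rule integrable_mult_continuous_on[OF continuous_inner gint[OF that]])
  have int3: "integrable M (\<lambda>x. g i x * g j x)" if "i \<in> I" "j \<in> I" for i j
    using that by (intro integrable_mult_square_integrable meas sq)
  \<comment> \<open>With t_i the weak integral of \<open>g i\<close>, the cross term is the inner
    product of t_i with Q t_i, which is the squared norm of \<open>r i\<close>. By orthonormality
    the double sum reduces in \<open>B\<close> to the same values, so the two contribute -2S + S =
    -S.\<close>
  have A: "(\<integral>x. inner (\<phi> x) (r i) * g i x \<partial>M) = (norm (r i))\<^sup>2" if "i \<in> I" for i
    using inner_weak_integral[OF gint[OF that], of "r i"]
      inner_residual_residual[OF U, of "weak_integral (g i)" "weak_integral (g i)"]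
    by (simp add: r_def power2_norm_eq_inner)
  have B: "(\<Sum>j\<in>I. inner (r i) (r j) * (\<integral>x. g i x * g j x \<partial>M)) = (norm (r i))\<^sup>2" if "i \<in> I" for i
  proof -
    have "(\<Sum>j\<in>I. inner (r i) (r j) * (\<integral>x. g i x * g j x \<partial>M))
        = (\<Sum>j\<in>I. if i = j then (norm (r i))\<^sup>2 else 0)"
      using that by (intro sum.cong) (auto simp: orth power2_norm_eq_inner)
    then show ?thesis using that I by simp
  qed
  have "0 \<le> (\<integral>x. (norm (residual U (\<phi> x) - (\<Sum>i\<in>I. g i x *\<^sub>R r i)))\<^sup>2 \<partial>M)"
    by simp
  also have "\<dots> = (\<integral>x. (norm (residual U (\<phi> x)))\<^sup>2 \<partial>M)
      - 2 * (\<Sum>i\<in>I. (\<integral>x. inner (\<phi> x) (r i) * g i x \<partial>M))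
      + (\<Sum>i\<in>I. \<Sum>j\<in>I. inner (r i) (r j) * (\<integral>x. g i x * g j x \<partial>M))"
    unfolding expand using int1 int2 int3 by simp
  also have "\<dots> = (\<integral>x. (norm (residual U (\<phi> x)))\<^sup>2 \<partial>M) - (\<Sum>i\<in>I. (norm (r i))\<^sup>2)"
    using A B by simp
  finally show ?thesis by (simp add: r_def)
qed

section \<open>Eigenfunctions of the integral operator\<close>

text \<open>On \<open>X\<close> the function \<open>kernel_int_op M k g\<close> is the inner product
  of \<open>\<phi> x\<close> with \<open>weak_integral g\<close>. Integrating it against
  \<open>f\<close> gives the left side, while the eigenvalue equation gives the right side.\<close>

lemma inner_weak_integral_eigenfunction:
  assumes k: "\<And>x y. x \<in> X \<Longrightarrow> y \<in> X \<Longrightarrow> inner (\<phi> x) (\<phi> y) = k x y"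
    and f: "f \<in> borel_measurable M" "integrable M (\<lambda>x. (f x)\<^sup>2)"
    and g: "g \<in> borel_measurable M" "integrable M (\<lambda>x. (g x)\<^sup>2)"
    and eig: "AE x in M. kernel_int_op M k g x = \<mu> * g x"
  shows "inner (weak_integral f) (weak_integral g) = \<mu> * (\<integral>x. f x * g x \<partial>M)"
proof -
  have fi: "integrable M f" and gi: "integrable M g"
    using f g by (auto intro: integrable_square_integrable)
  have [measurable]: "(\<lambda>x. inner (\<phi> x) (weak_integral g)) \<in> borel_measurable M"
    by (rule measurable_continuous_on) auto
  note [measurable] = f(1) g(1)
  have "kernel_int_op M k g x = inner (\<phi> x) (weak_integral g)" if "x \<in> X" for x
    unfolding kernel_int_op_def inner_commute[of "\<phi> x"] inner_weak_integral[OF gi]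
    using that by (intro Bochner_Integration.integral_cong) (simp_all add: space_M k inner_commute[of "\<phi> _" "\<phi> x"])
  then have "AE x in M. kernel_int_op M k g x = inner (\<phi> x) (weak_integral g)"
    by (intro AE_I2) (simp add: space_M)
  with eig have "AE x in M. inner (\<phi> x) (weak_integral g) = \<mu> * g x"
    by eventually_elim simp
  then have "AE x in M. inner (\<phi> x) (weak_integral g) * f x = \<mu> * (f x * g x)"
    by eventually_elim simp
  then have "(\<integral>x. inner (\<phi> x) (weak_integral g) * f x \<partial>M) = (\<integral>x. \<mu> * (f x * g x) \<partial>M)"
    by (rule integral_cong_AE[rotated 2]) measurable
  then show ?thesis unfolding inner_weak_integral[OF fi] by simp
qed

end

text \<open>The spectrum is specified through a separate orthonormal family for each nonzero
  eigenvalue; here they are merged into one sequence indexed like \<open>lam\<close>. Orthogonality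
  is claimed within one eigenspace only; between different ones it follows later from
  symmetry.\<close>

lemma eigenfunction_sequence:
  assumes "kernel_eigenvalues \<rho> k lam"
  shows "\<exists>g :: nat \<Rightarrow> 'a \<Rightarrow> real. \<forall>i. lam i \<noteq> 0 \<longrightarrow>
    g i \<in> borel_measurable \<rho> \<and> integrable \<rho> (\<lambda>x. (g i x)\<^sup>2) \<and>
    (AE x in \<rho>. kernel_int_op \<rho> k (g i) x = lam i * g i x) \<and>
    (\<forall>j. lam i = lam j \<longrightarrow> integral\<^sup>L \<rho> (\<lambda>x. g i x * g j x) = (if i = j then 1 else 0))"
proof -
  define c where "c \<mu> = card {i. lam i = \<mu>}" for \<mu>
  define P where "P \<mu> F \<longleftrightarrow>
        (\<forall>i<c \<mu>. F i \<in> borel_measurable \<rho> \<and> integrable \<rho> (\<lambda>x. (F i x)\<^sup>2) \<and>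
               (AE x in \<rho>. kernel_int_op \<rho> k (F i) x = \<mu> * F i x)) \<and>
        (\<forall>i<c \<mu>. \<forall>j<c \<mu>. integral\<^sup>L \<rho> (\<lambda>x. F i x * F j x) = (if i = j then 1 else 0))"
    for \<mu> and F :: "nat \<Rightarrow> 'a \<Rightarrow> real"
  have fin: "finite {i. lam i = \<mu>}" if "\<mu> \<noteq> 0" for \<mu>
    using assms that by (auto simp: kernel_eigenvalues_def)
  have "\<exists>F. \<mu> \<noteq> 0 \<longrightarrow> P \<mu> F" for \<mu>
    using assms unfolding kernel_eigenvalues_def eig_orthonormal_family_def P_def c_def by blast
  then obtain F where F: "\<And>\<mu>. \<mu> \<noteq> 0 \<Longrightarrow> P \<mu> (F \<mu>)" by metis
  \<comment> \<open>The rank of \<open>i\<close> among the indices with the same eigenvalue picks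
    the member of the family belonging to \<open>lam i\<close>.\<close>
  define rk where "rk i = card {j. j < i \<and> lam j = lam i}" for i
  define g where "g i = F (lam i) (rk i)" for i
  have rk: "rk i < c (lam i)" if "lam i \<noteq> 0" for i
    unfolding rk_def c_def using fin[OF that] by (intro psubset_card_mono) auto
  have mono: "rk i < rk j" if "i < j" "lam i = lam j" for i j
    unfolding rk_def using that by (intro psubset_card_mono) auto
  have inj: "rk i = rk j \<longleftrightarrow> i = j" if "lam i = lam j" for i j
    using mono[of i j] mono[of j i] that by (metis less_irrefl linorder_neqE_nat)
  show ?thesis
  proof (intro exI[of _ g] allI impI conjI)
    fix i j assume "lam i \<noteq> 0" "lam i = lam j"
    then show "integral\<^sup>L \<rho> (\<lambda>x. g i x * g j x) = (if i = j then 1 else 0)"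
      using F[of "lam i"] rk[of i] rk[of j] inj[of i j] by (simp add: P_def g_def)
  qed (use F rk in \<open>auto simp: P_def g_def\<close>)
qed

section \<open>The trace bound\<close>

text \<open>The weights \<open>c\<close> remove total mass at most \<open>n\<close>, at most 1 per
  index, so the worst they can do is to delete the \<open>n\<close> largest terms. The proof
  compares both sides with the pivot value \<open>lam n\<close>: mass removed from the tail costs at
  most \<open>lam n\<close> per unit, and mass kept in the head gains at least that much.\<close>

lemma tail_sum_le_weighted_sum:
  fixes lam c :: "nat \<Rightarrow> real"
  assumes "antimono lam" "\<And>i. 0 \<le> lam i" "\<And>i. c i \<le> 1" "\<And>i. 0 \<le> c i" "(\<Sum>i<N + n. c i) \<le> real n"
  shows "(\<Sum>i<N. lam (i + n)) \<le> (\<Sum>i<N + n. lam i * (1 - c i))"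
proof -
  have split: "(\<Sum>i<N + n. f i) = (\<Sum>i<n. f i) + (\<Sum>i<N. f (i + n))" for f :: "nat \<Rightarrow> real"
    by (induction N) (auto simp: add.commute)
  have "(\<Sum>i<N. lam (i + n) * c (i + n)) \<le> (\<Sum>i<N. lam n * c (i + n))"
    using assms(1,4) by (intro sum_mono mult_right_mono) (auto simp: antimono_def)
  moreover have "(\<Sum>i<n. lam n * (1 - c i)) \<le> (\<Sum>i<n. lam i * (1 - c i))"
    using assms(1,3) by (intro sum_mono mult_right_mono) (auto simp: antimono_def)
  moreover have "0 \<le> lam n * (real n - (\<Sum>i<n. c i) - (\<Sum>i<N. c (i + n)))"
    using assms(2,5) split[of c] by (intro mult_nonneg_nonneg) auto
  ultimately show ?thesis
    unfolding split
    by (simp add: algebra_simps sum_subtractf sum_distrib_left)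
qed

lemma (in compact_feature_map) eigenvalue_tail:
  assumes k: "\<And>x y. x \<in> X \<Longrightarrow> y \<in> X \<Longrightarrow> inner (\<phi> x) (\<phi> y) = k x y"
    and lam: "kernel_eigenvalues M k lam"
    and U: "orthonormal U" "card U \<le> n"
  shows "summable (\<lambda>i. lam (i + n))"
    and "(\<Sum>i. lam (i + n)) \<le> (\<integral>x. (norm (residual U (\<phi> x)))\<^sup>2 \<partial>M)"
proof -
  obtain g where G: "\<forall>i. lam i \<noteq> 0 \<longrightarrow>
      g i \<in> borel_measurable M \<and> integrable M (\<lambda>x. (g i x)\<^sup>2) \<and>
      (AE x in M. kernel_int_op M k (g i) x = lam i * g i x) \<and>
      (\<forall>j. lam i = lam j \<longrightarrow> (\<integral>x. g i x * g j x \<partial>M) = (if i = j then 1 else 0))"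
    using eigenfunction_sequence[OF lam] by (rule exE)
  have g: "g i \<in> borel_measurable M" "integrable M (\<lambda>x. (g i x)\<^sup>2)"
    "AE x in M. kernel_int_op M k (g i) x = lam i * g i x" if "lam i \<noteq> 0" for i
    using G that by blast+
  have gorth: "(\<integral>x. g i x * g j x \<partial>M) = (if i = j then 1 else 0)"
    if "lam i \<noteq> 0" "lam i = lam j" for i j
    using G that by blast
  define t where "t i = weak_integral (g i)" for i
  have inner_t: "inner (t i) (t j) = lam j * (\<integral>x. g i x * g j x \<partial>M)"
    if "lam i \<noteq> 0" "lam j \<noteq> 0" for i j
    unfolding t_def using that by (intro inner_weak_integral_eigenfunction[OF k] g)
  have orth: "(\<integral>x. g i x * g j x \<partial>M) = (if i = j then 1 else 0)"
    if "lam i \<noteq> 0" "lam j \<noteq> 0" for i j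
  proof (cases "lam i = lam j")
    case False
    \<comment> \<open>Both sides are the inner product of \<open>t i\<close> and \<open>t j\<close>,
      evaluated in either order; distinct eigenvalues force the integral to vanish.\<close>
    have "lam j * (\<integral>x. g i x * g j x \<partial>M) = lam i * (\<integral>x. g i x * g j x \<partial>M)"
      using inner_t[OF that] inner_t[OF that(2,1)] by (simp add: inner_commute mult.commute)
    then show ?thesis using False by auto
  qed (simp add: gorth that)
  have norm_t: "(norm (t i))\<^sup>2 = lam i" if "lam i \<noteq> 0" for i
    using inner_t[OF that that] orth[OF that that] by (simp add: power2_norm_eq_inner)
  have nonneg: "lam i \<ge> 0" for i
    using norm_t[of i] zero_le_power2[of "norm (t i)"] by (cases "lam i = 0") auto
  \<comment> \<open>The normalised \<open>t i\<close>. The value 0 at zero eigenvalues makes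
    \<open>c i\<close> vanish there, so the bounds on \<open>c\<close> hold at every index.\<close>
  define e where "e i = (if lam i = 0 then 0 else t i /\<^sub>R sqrt (lam i))" for i
  have t_e: "t i = sqrt (lam i) *\<^sub>R e i" if "lam i \<noteq> 0" for i
    using that by (simp add: e_def)
  define c where "c i = (\<Sum>u\<in>U. (inner (e i) u)\<^sup>2)" for i
  have norm_e: "(norm (e i))\<^sup>2 \<le> 1" for i
    using norm_t[of i] nonneg[of i]
    by (auto simp: e_def power_mult_distrib power_inverse divide_simps)
  have c_le: "c i \<le> 1" for i
    using bessel_finite[OF U(1), of "e i"] norm_e[of i] by (simp add: c_def)
  have c_nonneg: "c i \<ge> 0" for i by (simp add: c_def sum_nonneg)
  have inner_e: "inner (e i) (e j) = (if i = j then 1 else 0)" if "lam i \<noteq> 0" "lam j \<noteq> 0" for i j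
    using that nonneg[of i] nonneg[of j]
    by (auto simp: e_def inner_t orth field_simps simp flip: power2_eq_square)
  \<comment> \<open>After exchanging the sums, Bessel's inequality for the orthonormal vectors
    \<open>e i\<close> bounds the contribution of each unit vector of \<open>U\<close> by 1, and
    \<open>U\<close> has at most \<open>n\<close> elements.\<close>
  have sum_c: "(\<Sum>i<N. c i) \<le> real n" for N
  proof -
    define I where "I = {i. i < N \<and> lam i \<noteq> 0}"
    have "inj_on e I"
    proof (rule inj_onI)
      fix i j assume "i \<in> I" "j \<in> I" "e i = e j"
      then show "i = j" using inner_e[of i i] inner_e[of i j] by (simp add: I_def split: if_splits)
    qed
    have on: "orthonormal (e ` I)"
      unfolding orthonormal_def using inner_e \<open>inj_on e I\<close>
      by (auto simp: I_def inj_on_def)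
    have "(\<Sum>i<N. (inner (e i) u)\<^sup>2) \<le> 1" if "u \<in> U" for u
    proof -
      have "(\<Sum>i<N. (inner (e i) u)\<^sup>2) = (\<Sum>i\<in>I. (inner u (e i))\<^sup>2)"
        by (rule sum.mono_neutral_cong_right) (auto simp: I_def e_def inner_commute)
      also have "\<dots> = (\<Sum>w\<in>e ` I. (inner u w)\<^sup>2)"
        using \<open>inj_on e I\<close> by (simp add: sum.reindex)
      also have "\<dots> \<le> (norm u)\<^sup>2" by (rule bessel_finite[OF on])
      also have "\<dots> = 1" using U(1) that by (simp add: orthonormal_def power2_norm_eq_inner)
      finally show ?thesis .
    qed
    then have "(\<Sum>u\<in>U. \<Sum>i<N. (inner (e i) u)\<^sup>2) \<le> (\<Sum>u\<in>U. 1)"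
      by (rule sum_mono)
    also have "\<dots> \<le> real n" using U(2) by simp
    finally show ?thesis unfolding c_def by (subst sum.swap)
  qed
  have res: "(norm (residual U (t i)))\<^sup>2 = lam i * (1 - c i)" if "lam i \<noteq> 0" for i
    unfolding norm_residual_sq[OF U(1)] norm_t[OF that]
    using nonneg[of i]
    by (simp add: t_e[OF that] c_def power_mult_distrib algebra_simps sum_distrib_left)
  have partial: "(\<Sum>i<N. lam (i + n)) \<le> (\<integral>x. (norm (residual U (\<phi> x)))\<^sup>2 \<partial>M)" for N
  proof -
    \<comment> \<open>Summing up to \<open>N + n\<close> leaves exactly \<open>N\<close> terms in
      the tail; indices with \<open>lam i = 0\<close>, which need not carry an eigenfunction, add
      nothing.\<close>
    define I where "I = {i. i < N + n \<and> lam i \<noteq> 0}"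
    have "antimono lam" using lam by (simp add: kernel_eigenvalues_def)
    then have "(\<Sum>i<N. lam (i + n)) \<le> (\<Sum>i<N + n. lam i * (1 - c i))"
      by (intro tail_sum_le_weighted_sum nonneg c_le c_nonneg sum_c)
    also have "\<dots> = (\<Sum>i\<in>I. (norm (residual U (t i)))\<^sup>2)"
      by (rule sum.mono_neutral_cong_right) (auto simp: I_def res)
    also have "\<dots> \<le> (\<integral>x. (norm (residual U (\<phi> x)))\<^sup>2 \<partial>M)"
      unfolding t_def
      by (intro sum_residual_weak_integral_le[OF U(1)]) (auto simp: I_def g orth)
    finally show ?thesis .
  qed
  show summ: "summable (\<lambda>i. lam (i + n))"
    by (rule summableI_nonneg_bounded[OF nonneg partial])
  show "(\<Sum>i. lam (i + n)) \<le> (\<integral>x. (norm (residual U (\<phi> x)))\<^sup>2 \<partial>M)"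
    by (rule suminf_le_const[OF summ partial])
qed

section \<open>Continuity of the feature map, and the two error bounds\<close>

lemma continuous_on_feature_map:
  fixes \<phi> :: "'a::topological_space \<Rightarrow> 'h::real_inner"
  assumes "continuous_on (X \<times> X) (\<lambda>(x, y). k x y)"
    and k: "\<And>x y. x \<in> X \<Longrightarrow> y \<in> X \<Longrightarrow> inner (\<phi> x) (\<phi> y) = k x y"
  shows "continuous_on X \<phi>"
  unfolding continuous_on_def
proof
  fix x assume "x \<in> X"
  have comp: "continuous_on X (\<lambda>y. k (p y) (q y))"
    if "continuous_on X p" "continuous_on X q" "p ` X \<subseteq> X" "q ` X \<subseteq> X" for p q
    using continuous_on_compose2[OF assms(1) continuous_on_Pair[OF that(1,2)]] that(3,4) by auto
  \<comment> \<open>The distance from \<open>\<phi> y\<close> to \<open>\<phi> x\<close> written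
    through the kernel, hence continuous in \<open>y\<close> and zero at \<open>x\<close>.\<close>
  define d where "d y = sqrt (k y y - 2 * k y x + k x x)" for y
  have "continuous_on X d"
    unfolding d_def using \<open>x \<in> X\<close> by (intro continuous_intros comp) auto
  then have "(d \<longlongrightarrow> d x) (at x within X)" using \<open>x \<in> X\<close> by (simp add: continuous_on_def)
  then have lim: "(d \<longlongrightarrow> 0) (at x within X)" by (simp add: d_def)
  have "norm (\<phi> y - \<phi> x) = d y" if "y \<in> X" for y
    using that \<open>x \<in> X\<close> k[of x y] k[of y x]
    by (simp add: d_def norm_eq_sqrt_inner inner_diff_left inner_diff_right k inner_commute)
  then have "((\<lambda>y. \<phi> y - \<phi> x) \<longlongrightarrow> 0) (at x within X)"
    by (intro Lim_null_comparison[OF _ lim]) (auto simp: eventually_at_topological)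
  then show "(\<phi> \<longlongrightarrow> \<phi> x) (at x within X)" by (simp add: LIM_zero_iff)
qed

theorem theorem4:
  fixes X :: "'a::euclidean_space set"
    and k :: "'a \<Rightarrow> 'a \<Rightarrow> real"
    and phi :: "'a \<Rightarrow> 'h::{real_inner,complete_space}"
    and \<rho> :: "'a measure"
    and lam :: "nat \<Rightarrow> real"
    and n :: nat
    and xs :: "nat \<Rightarrow> 'a"
    and G :: "('a \<Rightarrow> real) \<Rightarrow> ('a \<Rightarrow> real)"
  assumes "compact X"
    and "continuous_on (X \<times> X) (\<lambda>(x, y). k x y)"
    and "pd_kernel X k"
    and "\<forall>x\<in>X. k x x \<le> 1"
    and "rkhs_repr X k phi"
    and "prob_space \<rho>" and "space \<rho> = X" and "sets \<rho> = sets (restrict_space borel X)"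
    and "kernel_eigenvalues \<rho> k lam"
    and "n \<ge> 1" and "\<forall>i<n. xs i \<in> X"
    and "\<forall>f\<in>rkhs_unit_ball X phi. continuous_on X (G f) \<and> bounded (G f ` X)"
    and "\<forall>f\<in>rkhs_unit_ball X phi. \<forall>f'\<in>rkhs_unit_ball X phi.
           (\<forall>i<n. f (xs i) = f' (xs i)) \<longrightarrow> (\<forall>x\<in>X. G f x = G f' x)"
  shows "(SUP f\<in>rkhs_unit_ball X phi. SUP x\<in>X. ereal \<bar>f x - G f x\<bar>)
           \<ge> ereal (sqrt (\<Sum>i. lam (i + n)))
         \<and> ((\<forall>f\<in>rkhs_unit_ball X phi. \<forall>x\<in>X. G f x \<ge> f x) \<longrightarrow>
            (SUP f\<in>rkhs_unit_ball X phi. ereal (integral\<^sup>L \<rho> (\<lambda>x. G f x - f x)))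
              \<ge> ereal (\<Sum>i. lam (i + n)))"
proof -
  have k: "\<And>x y. x \<in> X \<Longrightarrow> y \<in> X \<Longrightarrow> inner (phi x) (phi y) = k x y"
    using assms(5) by (simp add: rkhs_repr_def)
  interpret prob_space \<rho> by fact
  interpret compact_feature_map \<rho> X phi
    using assms continuous_on_feature_map[OF assms(2) k] by unfold_locales
  define B where "B = (\<lambda>i. phi (xs i)) ` {..<n}"
  obtain U where U: "orthonormal U" "card U \<le> card B" "span U = span B"
    using orthonormal_basis_exists[of B] by (auto simp: B_def)
  have "card U \<le> n"
    using U(2) card_image_le[of "{..<n}" "\<lambda>i. phi (xs i)"] by (simp add: B_def)
  define p where "p x = norm (residual U (phi x))" for x
  define ev where "ev h = (\<lambda>x. if x \<in> X then inner h (phi x) else 0)" for h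
  have ev_ball: "ev h \<in> rkhs_unit_ball X phi" if "norm h \<le> 1" for h
    using that by (auto simp: rkhs_unit_ball_def ev_def)
  have tail: "(\<Sum>i. lam (i + n)) \<le> (\<integral>x. (p x)\<^sup>2 \<partial>\<rho>)"
    unfolding p_def by (rule eigenvalue_tail(2)[OF k assms(9) U(1) \<open>card U \<le> n\<close>])
  have p_cont: "continuous_on X p"
    unfolding p_def by (intro continuous_intros continuous_residual)
  have p_le1: "p x \<le> 1" if "x \<in> X" for x
  proof -
    have "(p x)\<^sup>2 \<le> (norm (phi x))\<^sup>2"
      by (simp add: p_def norm_residual_sq[OF U(1)] sum_nonneg)
    also have "\<dots> \<le> 1" using k[OF that that] assms(4) that by (simp add: power2_norm_eq_inner)
    finally show ?thesis by (simp add: p_def power_le_one_iff abs_square_le_1)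
  qed
  \<comment> \<open>The fooling function for the point \<open>x\<close>: it vanishes at all nodes
    and has value \<open>p x\<close> at \<open>x\<close>. If \<open>p x = 0\<close>, division by
    zero gives 0, so the norm bound and the value remain correct.\<close>
  define f where "f x = residual U (phi x) /\<^sub>R p x" for x
  have f_norm: "norm (f x) \<le> 1" for x
    by (cases "p x = 0") (simp_all add: f_def p_def)
  have f_val: "inner (f x) (phi x) = p x" for x
    using inner_residual_residual[OF U(1), of "phi x" "phi x"]
    by (simp add: f_def p_def inner_commute divide_simps flip: power2_norm_eq_inner)
       (simp add: power2_eq_square)
  have f_xs: "inner (f x) (phi (xs i)) = 0" if "i < n" for x i
  proof -
    have "phi (xs i) \<in> span U" using that by (auto simp: U(3) B_def intro!: span_base)
    then show ?thesis by (simp add: f_def inner_residual_span[OF U(1)])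
  qed
  have G_eq: "G (ev (s *\<^sub>R f x)) y = G (ev 0) y" if "\<bar>s\<bar> \<le> 1" "y \<in> X" for s x y
  proof -
    have "ev (s *\<^sub>R f x) \<in> rkhs_unit_ball X phi"
      using that f_norm[of x] by (intro ev_ball) (simp add: mult_le_one)
    moreover have "ev 0 \<in> rkhs_unit_ball X phi" by (rule ev_ball) simp
    moreover have "\<forall>i<n. ev (s *\<^sub>R f x) (xs i) = ev 0 (xs i)"
      using f_xs by (simp add: ev_def)
    ultimately show ?thesis using assms(13) \<open>y \<in> X\<close> by blast
  qed
  have sup_ge: "ereal (p x) \<le> (SUP f\<in>rkhs_unit_ball X phi. SUP x\<in>X. ereal \<bar>f x - G f x\<bar>)"
    if "x \<in> X" for x
  proof -
    \<comment> \<open>Choosing the sign of the fooling function opposite to that of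
      \<open>G (ev 0) x\<close> makes the error at \<open>x\<close> at least
      \<open>p x\<close>.\<close>
    have "\<exists>s. \<bar>s\<bar> = 1 \<and> p x \<le> \<bar>ev (s *\<^sub>R f x) x - G (ev 0) x\<bar>"
    proof (cases "G (ev 0) x \<le> 0")
      case True
      then show ?thesis using that by (intro exI[of _ 1]) (simp add: ev_def f_val)
    next
      case False
      then show ?thesis using that
        by (intro exI[of _ "-1"]) (simp add: ev_def f_val p_def abs_if)
    qed
    then obtain s where s: "\<bar>s\<bar> = 1" "p x \<le> \<bar>ev (s *\<^sub>R f x) x - G (ev (s *\<^sub>R f x)) x\<bar>"
      using G_eq[OF _ \<open>x \<in> X\<close>] by auto
    have "ev (s *\<^sub>R f x) \<in> rkhs_unit_ball X phi"
      using s(1) f_norm[of x] by (intro ev_ball) simp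
    then show ?thesis
      using s(2) that by (intro SUP_upper2[of "ev (s *\<^sub>R f x)"] SUP_upper2[of x]) auto
  qed
  show ?thesis
  proof (intro conjI impI)
    let ?S = "SUP f\<in>rkhs_unit_ball X phi. SUP x\<in>X. ereal \<bar>f x - G f x\<bar>"
    have "X \<noteq> {}" using not_empty space_M by simp
    then obtain x0 where x0: "x0 \<in> X" "\<And>x. x \<in> X \<Longrightarrow> p x \<le> p x0"
      using continuous_attains_sup[OF compact_X _ p_cont] by blast
    \<comment> \<open>The mean of the square of \<open>p\<close> under a probability measure is at
      most its maximum, attained at \<open>x0\<close>.\<close>
    have "(\<integral>x. (p x)\<^sup>2 \<partial>\<rho>) \<le> (\<integral>x. (p x0)\<^sup>2 \<partial>\<rho>)"
      by (intro integral_mono integrable_continuous_on continuous_intros p_cont power_mono)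
         (auto simp: space_M p_def[abs_def] intro: x0(2)[unfolded p_def])
    then have "(\<Sum>i. lam (i + n)) \<le> (p x0)\<^sup>2"
      using tail by (simp add: prob_space)
    then have "sqrt (\<Sum>i. lam (i + n)) \<le> p x0"
      by (simp add: p_def real_le_lsqrt real_sqrt_le_iff')
    then show "ereal (sqrt (\<Sum>i. lam (i + n))) \<le> ?S"
      using sup_ge[OF x0(1)] by (meson ereal_less_eq(3) order_trans)
  next
    assume above: "\<forall>f\<in>rkhs_unit_ball X phi. \<forall>x\<in>X. f x \<le> G f x"
    have zero: "ev 0 \<in> rkhs_unit_ball X phi" by (rule ev_ball) simp
    \<comment> \<open>\<open>G\<close> cannot tell the fooling function at \<open>x\<close> from 0,
      so its upper bound for 0 must also dominate the value \<open>p x\<close>.\<close>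
    have G0: "p x \<le> G (ev 0) x" if "x \<in> X" for x
      using above ev_ball[OF f_norm[of x]] G_eq[of 1 x x] that f_val[of x]
      by (force simp: ev_def)
    have "(\<Sum>i. lam (i + n)) \<le> (\<integral>x. (p x)\<^sup>2 \<partial>\<rho>)" by (rule tail)
    also have "\<dots> \<le> (\<integral>x. G (ev 0) x \<partial>\<rho>)"
    proof (rule integral_mono)
      fix x assume "x \<in> space \<rho>"
      \<comment> \<open>The normalisation \<open>k x x \<le> 1\<close> enters here, through
        \<open>p x \<le> 1\<close>.\<close>
      then have "(p x)\<^sup>2 \<le> p x"
        using p_le1[of x] by (simp add: power2_eq_square p_def space_M mult_left_le)
      then show "(p x)\<^sup>2 \<le> G (ev 0) x" using G0[of x] \<open>x \<in> space \<rho>\<close> by (simp add: space_M)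
    next
      show "integrable \<rho> (G (ev 0))" using assms(12) zero by (intro integrable_continuous_on) auto
    qed (intro integrable_continuous_on continuous_intros p_cont)
    \<comment> \<open>The zero function alone witnesses the second bound: the mean of
      \<open>G (ev 0)\<close> is its mean error.\<close>
    also have "\<dots> = (\<integral>x. G (ev 0) x - ev 0 x \<partial>\<rho>)"
      by (rule Bochner_Integration.integral_cong) (simp_all add: ev_def)
    finally show "ereal (\<Sum>i. lam (i + n))
        \<le> (SUP f\<in>rkhs_unit_ball X phi. ereal (integral\<^sup>L \<rho> (\<lambda>x. G f x - f x)))"
      using zero by (intro SUP_upper2[of "ev 0"]) auto
  qed
qed

end
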